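(* Let $q\geq 1$, and let $a,b_1,\dots,b_q,B_1,\dots,B_q$ be real numbers such that $b_j\geq 2a\geq 2$ and $B_j\geq 2$ for all $1\leq j\leq q$, and $\prod_{j=1}^q\Gamma(b_j+B_j)\geq 2a\prod_{j=1}^q\Gamma(b_j)$. Then the function $${}_1\tilde{\Psi}_q\left[{(a,1)\atop (b_1,B_1),\dots,(b_q,B_q)}\Big|z\right]=\frac{\prod_{j=1}^q\Gamma(b_j)}{\Gamma(a)}\sum_{k=0}^\infty\frac{\Gamma(a+k)}{\prod_{j=1}^q\Gamma(b_j+kB_j)}\frac{z^{k+1}}{k!}$$ is starlike in $\mathcal{D}=\{z\in\mathbb{C}:|z|<1\}$.
   Context: A function $f(z)=z+\sum_{k\ge2}a_kz^k$ analytic in $\mathcal{D}$ is starlike in $\mathcal{D}$ if it is univalent and $f(\mathcal{D})$ is starlike with respect to the origin ($tw\in f(\mathcal{D})$ for $w\in f(\mathcal{D})$, $t\in[0,1]$); equivalently, $\Re\left(zf'(z)/f(z)\right)>0$ for all $z\in\mathcal{D}$. *)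

theory Defs
  imports "HOL-Complex_Analysis.Complex_Analysis"
begin

text \<open>The library predicate \<^const>\<open>starlike\<close> leaves the centre of a starlike set unspecified;
  here the centre has to be the origin.\<close>

definition starlike_wrt_0 :: "complex set \<Rightarrow> bool" where
  "starlike_wrt_0 S \<longleftrightarrow> (\<forall>w\<in>S. \<forall>t\<in>{0..1::real}. of_real t * w \<in> S)"

text \<open>The conditions \<open>f 0 = 0\<close> and \<open>deriv f 0 = 1\<close> express that the power series of \<open>f\<close> at \<open>0\<close>
  has the form \<open>z + a\<^sub>2 z\<^sup>2 + a\<^sub>3 z\<^sup>3 + \<dots>\<close>; univalence is holomorphy together with injectivity.\<close>

definition starlike_fun :: "(complex \<Rightarrow> complex) \<Rightarrow> bool" where
  "starlike_fun f \<longleftrightarrow>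
     f holomorphic_on ball 0 1 \<and> f 0 = 0 \<and> deriv f 0 = 1 \<and>
     inj_on f (ball 0 1) \<and> starlike_wrt_0 (f ` ball 0 1)"

text \<open>The normalized Fox-Wright function with upper parameter \<open>(a, 1)\<close> and lower parameters
  \<open>(b 1, B 1), \<dots>, (b q, B q)\<close>. Values of \<open>b\<close> and \<open>B\<close> outside \<open>{1..q}\<close> are irrelevant.\<close>

definition fox_wright_1 ::
  "nat \<Rightarrow> real \<Rightarrow> (nat \<Rightarrow> real) \<Rightarrow> (nat \<Rightarrow> real) \<Rightarrow> complex \<Rightarrow> complex" where
  "fox_wright_1 q a b B z =
     of_real ((\<Prod>j=1..q. Gamma (b j)) / Gamma a) *
     (\<Sum>k. of_real (Gamma (a + real k) / (\<Prod>j=1..q. Gamma (b j + real k * B j))) *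
           (z ^ (k + 1) / fact k))"

end

theory Submission
  imports Defs
begin

text \<open>
  Write \<open>f z = z + h z\<close> with \<open>h z = (\<Sum>k. d k * z ^ (k + 2))\<close>. If \<open>\<Sum>k. (2 k + 3) \<bar>d k\<bar> < 1\<close>, then \<open>h\<close> is a
  contraction on the unit disc, so \<open>f\<close> is injective. Given \<open>\<bar>z\<bar> < 1\<close> and \<open>t \<in> [0, 1]\<close>, the equation
  \<open>f u = t * f z\<close> is the fixed point problem for \<open>u \<mapsto> t * f z - h u\<close>, which maps the disc of
  centre \<open>t z\<close> and radius \<open>(1 - t) \<bar>z\<bar>\<close> into itself; since this disc lies in the unit disc, \<open>t * f z\<close>
  is a value of \<open>f\<close>. For the Fox-Wright function the coefficients are at most \<open>6\<^sup>-\<^sup>k\<close>, because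
  \<open>\<Gamma> (x + B) \<ge> x (x + 1) \<Gamma> x\<close> for \<open>x, B \<ge> 2\<close>.
\<close>

section \<open>Univalence and starlikeness from a weighted coefficient sum\<close>

context
  fixes d :: "nat \<Rightarrow> complex"
  assumes summable_d: "summable (\<lambda>k. real (2 * k + 3) * norm (d k))"
    and suminf_d: "(\<Sum>k. real (2 * k + 3) * norm (d k)) < 1"
begin

text \<open>The weights \<open>1\<close>, \<open>k + 1\<close> and \<open>k + 2\<close> used below
  are all dominated by \<open>2 * k + 3\<close>, so the single summability assumption covers every
  series that occurs.\<close>

lemma summable_weighted:
  assumes "\<And>k. \<bar>m k\<bar> \<le> real (2 * k + 3)"
  shows "summable (\<lambda>k. m k * norm (d k))"
proof (rule summable_comparison_test'[OF summable_d, of 0])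
  show "norm (m k * norm (d k)) \<le> real (2 * k + 3) * norm (d k)" for k
    using mult_right_mono[OF assms[of k], of "norm (d k)"] by (simp add: abs_mult)
qed

definition tail_powser :: "complex \<Rightarrow> complex" where
  "tail_powser z = (\<Sum>k. d k * z ^ (k + 2))"

lemma summable_tail_powser:
  assumes "norm z \<le> 1"
  shows "summable (\<lambda>k. d k * z ^ (k + 2))"
proof (rule summable_comparison_test'[of "\<lambda>k. 1 * norm (d k)" 0])
  show "summable (\<lambda>k. 1 * norm (d k))"
    by (rule summable_weighted) simp
  show "norm (d k * z ^ (k + 2)) \<le> 1 * norm (d k)" for k
    using assms unfolding norm_mult norm_power
    by (metis mult.commute mult_right_mono norm_ge_zero power_le_one)
qed

text \<open>Termwise this is \<open>norm (z ^ n - w ^ n) \<le> n * norm (z - w)\<close> on the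
  closed unit disc, with \<open>n = k + 2\<close>.\<close>

lemma norm_tail_powser_diff_le:
  assumes "norm z \<le> 1" "norm w \<le> 1"
  shows "norm (tail_powser z - tail_powser w) \<le> (\<Sum>k. real (k + 2) * norm (d k)) * norm (z - w)"
proof -
  have S: "summable (\<lambda>k. real (k + 2) * norm (d k))"
    by (rule summable_weighted) simp
  have "tail_powser z - tail_powser w = (\<Sum>k. d k * z ^ (k + 2) - d k * w ^ (k + 2))"
    unfolding tail_powser_def by (intro suminf_diff summable_tail_powser assms)
  also have "norm \<dots> \<le> (\<Sum>k. real (k + 2) * norm (d k) * norm (z - w))"
  proof (rule norm_suminf_le)
    show "norm (d k * z ^ (k + 2) - d k * w ^ (k + 2))
        \<le> real (k + 2) * norm (d k) * norm (z - w)" for k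
      using mult_left_mono[OF norm_power_diff[OF assms, of "k + 2"], of "norm (d k)"]
      unfolding right_diff_distrib[symmetric] norm_mult by (simp only: mult_ac norm_ge_zero)
  qed (intro summable_mult2 S)
  finally show ?thesis
    by (simp only: suminf_mult2[OF S])
qed

text \<open>This measures how far the tail is from commuting with scaling by \<open>t\<close>. The
  terms differ by \<open>d k * z ^ (k + 2) * t * (1 - t ^ (k + 1))\<close>, and
  \<open>1 - t ^ n \<le> n * (1 - t)\<close>. The bound keeps just one factor \<open>norm z\<close>,
  so that it is a multiple of the radius \<open>(1 - t) * norm z\<close> of the disc in the fixed
  point argument.\<close>

lemma norm_scaled_tail_powser_diff_le:
  assumes "norm z \<le> 1" "0 \<le> t" "t \<le> 1"
  shows "norm (of_real t * tail_powser z - tail_powser (of_real t * z))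
    \<le> (\<Sum>k. real (k + 1) * norm (d k)) * ((1 - t) * norm z)"
proof -
  have S: "summable (\<lambda>k. real (k + 1) * norm (d k))"
    by (rule summable_weighted) simp
  have tz: "norm (of_real t * z) \<le> 1"
    using assms by (simp add: norm_mult mult_le_one)
  have "of_real t * tail_powser z - tail_powser (of_real t * z)
      = (\<Sum>k. of_real t * (d k * z ^ (k + 2)) - d k * (of_real t * z) ^ (k + 2))"
    unfolding tail_powser_def suminf_mult[OF summable_tail_powser[OF assms(1)], symmetric]
    by (intro suminf_diff summable_mult summable_tail_powser assms tz)
  also have "norm \<dots> \<le> (\<Sum>k. real (k + 1) * norm (d k) * ((1 - t) * norm z))"
  proof (rule norm_suminf_le)
    fix k
    have "of_real t * (d k * z ^ (k + 2)) - d k * (of_real t * z) ^ (k + 2)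
        = d k * (z ^ (k + 2) * of_real (t * (1 - t ^ (k + 1))))"
      by (simp add: power_mult_distrib algebra_simps)
    also have "norm \<dots> = norm (d k) * (norm z ^ (k + 2) * (t * (1 - t ^ (k + 1))))"
      using assms by (simp add: norm_mult norm_power power_le_one mult_le_one del: of_real_diff)
    also have "\<dots> \<le> norm (d k) * (norm z * (real (k + 1) * (1 - t)))"
    proof (rule mult_left_mono, rule mult_mono)
      show "norm z ^ (k + 2) \<le> norm z"
        using assms power_decreasing[of 1 "k + 2" "norm z"] by simp
      have "t * (1 - t ^ (k + 1)) \<le> 1 * (1 - t ^ (k + 1))"
        using assms by (intro mult_right_mono) (auto simp: power_le_one mult_le_one)
      also have "\<dots> \<le> real (k + 1) * (1 - t)"
        using norm_power_diff[of 1 t "k + 1"] assms by simp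
      finally show "t * (1 - t ^ (k + 1)) \<le> real (k + 1) * (1 - t)" .
    qed (use assms in \<open>auto simp: power_le_one mult_le_one\<close>)
    finally show "norm (of_real t * (d k * z ^ (k + 2)) - d k * (of_real t * z) ^ (k + 2))
        \<le> real (k + 1) * norm (d k) * ((1 - t) * norm z)"
      by (simp add: mult_ac)
  qed (intro summable_mult2 S)
  finally show ?thesis
    by (simp only: suminf_mult2[OF S])
qed

text \<open>The identity \<open>(k + 2) + (k + 1) = 2 * k + 3\<close> explains the weight:
  \<open>L\<close> is the contraction constant, and \<open>K\<close> controls the failure to commute
  with scaling.\<close>

lemma tail_powser_bounds:
  defines "L \<equiv> (\<Sum>k. real (k + 2) * norm (d k))" and "K \<equiv> (\<Sum>k. real (k + 1) * norm (d k))"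
  shows "0 \<le> L" "0 \<le> K" "L + K < 1"
proof -
  have S: "summable (\<lambda>k. real (k + 2) * norm (d k))" "summable (\<lambda>k. real (k + 1) * norm (d k))"
    by (rule summable_weighted, simp)+
  show "0 \<le> L" "0 \<le> K"
    unfolding L_def K_def by (intro suminf_nonneg S; simp)+
  have "L + K = (\<Sum>k. real (2 * k + 3) * norm (d k))"
    unfolding L_def K_def by (subst suminf_add[OF S]) (simp add: algebra_simps)
  then show "L + K < 1"
    using suminf_d by simp
qed

lemma inj_on_id_plus_tail_powser: "inj_on (\<lambda>z. z + tail_powser z) (ball 0 1)"
proof (rule inj_onI)
  fix z w assume zw: "z \<in> ball 0 1" "w \<in> ball 0 1"
    and eq: "z + tail_powser z = w + tail_powser w"
  let ?L = "\<Sum>k. real (k + 2) * norm (d k)"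
  have "norm (z - w) = norm (tail_powser z - tail_powser w)"
    using eq by (metis add_diff_cancel_left' add_diff_eq diff_diff_eq2 norm_minus_commute)
  also have "\<dots> \<le> ?L * norm (z - w)"
    using zw by (intro norm_tail_powser_diff_le) auto
  finally have "(1 - ?L) * norm (z - w) \<le> 0"
    by (simp add: algebra_simps)
  moreover have "1 - ?L > 0"
    using tail_powser_bounds by linarith
  ultimately show "z = w"
    by (simp add: mult_le_0_iff)
qed

lemma starlike_wrt_0_id_plus_tail_powser:
  "starlike_wrt_0 ((\<lambda>z. z + tail_powser z) ` ball 0 1)"
  unfolding starlike_wrt_0_def
proof (intro ballI)
  fix w and t :: real
  assume w: "w \<in> (\<lambda>z. z + tail_powser z) ` ball 0 1" and "t \<in> {0..1}"
  then have t: "0 \<le> t" "t \<le> 1" by auto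
  from w obtain z where z: "norm z < 1" and w: "w = z + tail_powser z" by auto
  define L where "L = (\<Sum>k. real (k + 2) * norm (d k))"
  define K where "K = (\<Sum>k. real (k + 1) * norm (d k))"
  have LK: "0 \<le> L" "0 \<le> K" "L + K < 1"
    unfolding L_def K_def by (fact tail_powser_bounds)+
  \<comment> \<open>With this radius \<open>norm (t * z) + r = norm z\<close>, so the disc around
    \<open>t * z\<close> stays inside the closed disc of radius \<open>norm z < 1\<close>. It may
    degenerate to a point, as for \<open>t = 1\<close>.\<close>
  define r where "r = (1 - t) * norm z"
  have r: "0 \<le> r" using t by (simp add: r_def)
  define D where "D = cball (of_real t * z) r"
  have tz: "norm (of_real t * z) + r = norm z"
    using t by (simp add: r_def norm_mult algebra_simps)
  have D: "norm u \<le> norm z" if "u \<in> D" for u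
    using that norm_triangle_ineq2[of u "of_real t * z"] tz
    by (simp add: D_def dist_norm norm_minus_commute)
  have "\<exists>!u\<in>D. of_real t * w - tail_powser u = u"
  proof (rule Banach_fix)
    show "complete D" "D \<noteq> {}" using r by (auto simp: D_def complete_eq_closed)
    show "0 \<le> L" "L < 1" using LK by auto
    show "dist (of_real t * w - tail_powser x) (of_real t * w - tail_powser y) \<le> L * dist x y"
      if "x \<in> D" "y \<in> D" for x y
      using norm_tail_powser_diff_le[of x y] D[OF that(1)] D[OF that(2)] z
      by (simp add: dist_norm norm_minus_commute L_def)
    show "(\<lambda>u. of_real t * w - tail_powser u) ` D \<subseteq> D"
    proof (rule image_subsetI)
      fix u assume u: "u \<in> D"
      \<comment> \<open>Inserting the tail at \<open>t * z\<close> splits the displacement from the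
        centre into a scaling error, at most \<open>K * r\<close>, and a Lipschitz term, at most
        \<open>L * r\<close>. Their sum is at most \<open>r\<close> because
        \<open>L + K < 1\<close>.\<close>
      have "norm (of_real t * w - tail_powser u - of_real t * z)
          = norm ((of_real t * tail_powser z - tail_powser (of_real t * z))
             + (tail_powser (of_real t * z) - tail_powser u))"
        by (simp add: w algebra_simps)
      also have "\<dots> \<le> K * r + L * norm (of_real t * z - u)"
        using norm_tail_powser_diff_le[of "of_real t * z" u]
          norm_scaled_tail_powser_diff_le[of z t] t z D[OF u] tz r
        unfolding K_def L_def r_def by (intro norm_triangle_mono) auto
      also have "\<dots> \<le> K * r + L * r"
        using u LK by (intro add_left_mono mult_left_mono) (auto simp: D_def dist_norm)
      also have "\<dots> \<le> 1 * r"
        using LK r unfolding distrib_right[symmetric] by (intro mult_right_mono) auto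
      finally show "of_real t * w - tail_powser u \<in> D"
        by (simp add: D_def dist_norm norm_minus_commute)
    qed
  qed
  then obtain u where u: "u \<in> D" and fix_u: "of_real t * w - tail_powser u = u" by blast
  from fix_u have "of_real t * w = u + tail_powser u" by (simp add: algebra_simps)
  moreover have "u \<in> ball 0 1" using D[OF u] z by simp
  ultimately show "of_real t * w \<in> (\<lambda>z. z + tail_powser z) ` ball 0 1" by blast
qed

text \<open>Factoring out \<open>u\<^sup>2\<close> leaves a power series that converges at
  \<open>1\<close>, hence is differentiable in the open disc. The form \<open>1 + z * D\<close> with
  unspecified \<open>D\<close> gives both holomorphy and derivative \<open>1\<close> at the
  origin.\<close>

lemma id_plus_tail_powser_has_derivative:
  assumes "norm z < 1"
  shows "\<exists>D. ((\<lambda>z. z + tail_powser z) has_field_derivative 1 + z * D) (at z)"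
proof -
  have "summable (\<lambda>k. norm (d k))"
    using summable_weighted[of "\<lambda>_. 1"] by simp
  then have S: "summable (\<lambda>k. d k * 1 ^ k)"
    using summable_norm_cancel by auto
  have eq: "tail_powser u = u\<^sup>2 * (\<Sum>k. d k * u ^ k)" if "norm u < 1" for u
    using suminf_mult[OF powser_inside[OF S, of u], of "u\<^sup>2"] that
    by (simp add: tail_powser_def power2_eq_square mult_ac)
  obtain G where G: "((\<lambda>u. \<Sum>k. d k * u ^ k) has_field_derivative G) (at z)"
    using termdiffs_strong[OF S] assms by force
  have "((\<lambda>u. u + u\<^sup>2 * (\<Sum>k. d k * u ^ k)) has_field_derivative
      1 + z * (2 * (\<Sum>k. d k * z ^ k) + z * G)) (at z)"
    by (auto intro!: derivative_eq_intros G simp: algebra_simps power2_eq_square)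
  then have "((\<lambda>z. z + tail_powser z) has_field_derivative
      1 + z * (2 * (\<Sum>k. d k * z ^ k) + z * G)) (at z)"
    by (rule has_field_derivative_transform_within_open[of _ _ _ "ball 0 1"])
       (use assms in \<open>auto simp: eq\<close>)
  then show ?thesis by blast
qed

lemma starlike_fun_id_plus_tail_powser: "starlike_fun (\<lambda>z. z + tail_powser z)"
  unfolding starlike_fun_def
proof (intro conjI inj_on_id_plus_tail_powser starlike_wrt_0_id_plus_tail_powser)
  show "(\<lambda>z. z + tail_powser z) holomorphic_on ball 0 1"
    using id_plus_tail_powser_has_derivative by (subst holomorphic_on_open) force+
  show "0 + tail_powser 0 = 0"
    by (simp add: tail_powser_def)
  show "deriv (\<lambda>z. z + tail_powser z) 0 = 1"
    using id_plus_tail_powser_has_derivative[of 0] by (auto intro: DERIV_imp_deriv)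
qed

end

section \<open>Coefficient criteria for power series\<close>

lemma starlike_fun_cong:
  assumes "\<And>z. norm z < 1 \<Longrightarrow> f z = g z"
  shows "starlike_fun f \<longleftrightarrow> starlike_fun g"
proof -
  have "f holomorphic_on ball 0 1 \<longleftrightarrow> g holomorphic_on ball 0 1"
    by (rule holomorphic_cong) (auto simp: assms)
  moreover have "inj_on f (ball 0 1) \<longleftrightarrow> inj_on g (ball 0 1)"
    by (rule inj_on_cong) (auto simp: assms)
  moreover have "f ` ball 0 1 = g ` ball 0 1"
    by (rule image_cong) (auto simp: assms)
  moreover have "eventually (\<lambda>z. z \<in> ball 0 1) (nhds (0::complex))"
    by (intro eventually_nhds_in_open) auto
  then have "deriv f 0 = deriv g 0"
    by (intro deriv_cong_ev) (auto elim!: eventually_mono simp: assms)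
  ultimately show ?thesis
    by (simp add: starlike_fun_def assms)
qed

lemma starlike_fun_powser:
  fixes c :: "nat \<Rightarrow> complex"
  assumes c0: "c 0 = 1"
    and S: "summable (\<lambda>k. real (2 * k + 3) * norm (c (Suc k)))"
    and less: "(\<Sum>k. real (2 * k + 3) * norm (c (Suc k))) < 1"
  shows "starlike_fun (\<lambda>z. \<Sum>k. c k * z ^ (k + 1))"
proof -
  have eq: "(\<Sum>k. c k * z ^ (k + 1)) = z + tail_powser (\<lambda>k. c (Suc k)) z" if "norm z < 1" for z
  proof -
    have "summable (\<lambda>k. c (Suc k) * z ^ (k + 2))"
      using that by (intro summable_tail_powser[OF S less]) auto
    then have "summable (\<lambda>k. c k * z ^ (k + 1))"
      by (subst summable_Suc_iff[symmetric]) simp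
    from suminf_split_head[OF this] show ?thesis
      by (simp add: tail_powser_def[OF S less] c0)
  qed
  show ?thesis
    using starlike_fun_id_plus_tail_powser[OF S less] by (subst starlike_fun_cong[OF eq])
qed

text \<open>Since \<open>2 * k + 3 \<le> 3 * 2 ^ k\<close>, the weighted terms are at most
  \<open>(1 / 2) * (1 / 3) ^ k\<close>, whose sum is \<open>3 / 4 < 1\<close>.\<close>

lemma starlike_fun_powser_geometric:
  fixes c :: "nat \<Rightarrow> complex"
  assumes "c 0 = 1" and c: "\<And>k. norm (c k) \<le> (1 / 6) ^ k"
  shows "starlike_fun (\<lambda>z. \<Sum>k. c k * z ^ (k + 1))"
proof -
  have "real (2 * k + 3) \<le> 3 * 2 ^ k" for k
    by (induction k) auto
  then have "real (2 * k + 3) * norm (c (Suc k)) \<le> 3 * 2 ^ k * (1 / 6) ^ Suc k" for k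
    by (intro mult_mono c) auto
  moreover have "3 * 2 ^ k * (1 / 6) ^ Suc k = (1 / 2) * (1 / 3 :: real) ^ k" for k
    by (simp add: power_mult_distrib[symmetric] mult_ac)
  ultimately have le: "real (2 * k + 3) * norm (c (Suc k)) \<le> (1 / 2) * (1 / 3) ^ k" for k
    by metis
  have geom: "(\<lambda>k. (1 / 2) * (1 / 3 :: real) ^ k) sums (1 / 2 * (1 / (1 - 1 / 3)))"
    by (intro sums_mult geometric_sums) simp
  have S: "summable (\<lambda>k. real (2 * k + 3) * norm (c (Suc k)))"
    by (rule summable_comparison_test'[OF sums_summable[OF geom], of 0]) (use le in auto)
  have "(\<Sum>k. real (2 * k + 3) * norm (c (Suc k))) \<le> 1 / 2 * (1 / (1 - 1 / 3))"
    using suminf_le[OF le S sums_summable[OF geom]] sums_unique[OF geom] by simp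
  then show ?thesis
    using assms(1) S by (intro starlike_fun_powser) auto
qed

section \<open>Gamma estimates and the Fox-Wright coefficients\<close>

lemma Gamma_real_add_ge:
  fixes x B :: real
  assumes "x \<ge> 2" "B \<ge> 2"
  shows "Gamma (x + B) \<ge> x * (x + 1) * Gamma x"
proof -
  have "x * (x + 1) * Gamma x = Gamma (x + 1 + 1)"
    using assms Gamma_plus1[of x] Gamma_plus1[of "x + 1"]
    by (simp add: nonpos_Ints_def mult_ac)
  \<comment> \<open>Monotonicity of \<open>Gamma\<close> enters in its strict form, so the equality
    case \<open>B = 2\<close> is separate.\<close>
  also have "\<dots> \<le> Gamma (x + B)"
    using assms Gamma_real_strict_mono[of "x + 1 + 1" "x + B"]
    by (cases "B = 2") (auto simp: add_ac)
  finally show ?thesis .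
qed

theorem theorem2:
  fixes q :: nat and a :: real and b B :: "nat \<Rightarrow> real"
  assumes "q \<ge> 1"
    and "\<And>j. j \<in> {1..q} \<Longrightarrow> b j \<ge> 2 * a"
    and "2 * a \<ge> 2"
    and "\<And>j. j \<in> {1..q} \<Longrightarrow> B j \<ge> 2"
    and "(\<Prod>j=1..q. Gamma (b j + B j)) \<ge> 2 * a * (\<Prod>j=1..q. Gamma (b j))"
  shows "starlike_fun (fox_wright_1 q a b B)"
proof -
  define P where "P k = (\<Prod>j=1..q. Gamma (b j + real k * B j))" for k
  define C where "C k = P 0 / Gamma a * (Gamma (a + real k) / P k / fact k)" for k
  have x_ge: "b j + real k * B j \<ge> 2 * a + 2 * real k" if "j \<in> {1..q}" for j k
    using assms(2)[OF that] mult_left_mono[OF assms(4)[OF that], of "real k"] by simp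
  then have x_ge2: "b j + real k * B j \<ge> 2" if "j \<in> {1..q}" for j k
    using assms(3) that[THEN x_ge[of _ k]] by simp
  have Gamma_pos: "Gamma (b j + real k * B j) > 0" if "j \<in> {1..q}" for j k
    using x_ge2[OF that, of k] by (intro Gamma_real_pos) linarith
  then have P_pos: "P k > 0" for k
    unfolding P_def by (intro prod_pos) blast
  have C_nonneg: "C k \<ge> 0" for k
    unfolding C_def using P_pos assms(3) by (simp add: less_imp_le)
  have Gamma_a: "Gamma a > 0"
    using assms(3) by (intro Gamma_real_pos) linarith
  \<comment> \<open>The factor \<open>a + k\<close> cancels the growth of the numerator,
    \<open>Gamma (a + k + 1) = (a + k) * Gamma (a + k)\<close>; the \<open>6\<close> remains as the
    geometric ratio.\<close>
  have P_Suc: "6 * (a + real k) * P k \<le> P (Suc k)" for k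
  proof -
    let ?m = "6 * (a + real k)"
    have m: "?m \<ge> 1" using assms(3) by simp
    \<comment> \<open>As \<open>q \<ge> 1\<close> and \<open>?m \<ge> 1\<close>, each of the
      \<open>q\<close> Gamma factors can be given its own copy of \<open>?m\<close>, and the
      products are compared factor by factor.\<close>
    have "?m * P k \<le> ?m ^ q * P k"
      using power_increasing[OF assms(1) m] P_pos[of k] by (intro mult_right_mono) auto
    also have "\<dots> = (\<Prod>j=1..q. ?m * Gamma (b j + real k * B j))"
      by (simp add: P_def prod.distrib)
    also have "\<dots> \<le> P (Suc k)"
      unfolding P_def
    proof (rule prod_mono, intro conjI)
      fix j assume j: "j \<in> {1..q}"
      let ?x = "b j + real k * B j"
      have pos: "Gamma ?x > 0" by (rule Gamma_pos[OF j])
      then show "0 \<le> ?m * Gamma ?x" using m by simp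
      \<comment> \<open>Here \<open>6 = 2 * 3\<close> arises: \<open>?x \<ge> 2 * (a + k)\<close>
        and \<open>?x + 1 \<ge> 3\<close>.\<close>
      have "2 * (a + real k) * 3 \<le> ?x * (?x + 1)"
        using x_ge[OF j, of k] x_ge2[OF j, of k] assms(3) by (intro mult_mono) auto
      then have "?m * Gamma ?x \<le> ?x * (?x + 1) * Gamma ?x"
        using pos by (intro mult_right_mono) auto
      also have "\<dots> \<le> Gamma (?x + B j)"
        by (intro Gamma_real_add_ge x_ge2 assms(4) j)
      also have "?x + B j = b j + real (Suc k) * B j"
        by (simp add: algebra_simps)
      finally show "?m * Gamma ?x \<le> Gamma (b j + real (Suc k) * B j)" .
    qed
    finally show ?thesis .
  qed
  have C_Suc: "C (Suc k) \<le> C k / 6" for k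
  proof -
    have pos: "a + real k > 0" using assms(3) by simp
    then have G: "Gamma (a + real (Suc k)) = (a + real k) * Gamma (a + real k)"
      using Gamma_plus1[of "a + real k"] by (simp add: nonpos_Ints_def add_ac)
    have "C (Suc k) = C k * ((a + real k) * P k / (P (Suc k) * real (Suc k)))"
      using P_pos[of k] by (simp add: C_def G mult_ac del: of_nat_Suc)
    also have "(a + real k) * P k / (P (Suc k) * real (Suc k)) \<le> 1 / 6"
    proof -
      \<comment> \<open>The factor \<open>k + 1\<close> from the factorials is only bounded below by
        \<open>1\<close>.\<close>
      have "6 * ((a + real k) * P k) \<le> P (Suc k) * real (Suc k)"
        using P_Suc[of k] P_pos[of "Suc k"] mult_left_mono[of 1 "real (Suc k)" "P (Suc k)"]
        unfolding mult.assoc by linarith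
      then show ?thesis
        using P_pos[of "Suc k"] by (simp add: divide_le_eq del: of_nat_Suc)
    qed
    finally show ?thesis
      using C_nonneg[of k] by (simp add: mult_left_mono)
  qed
  have C_0: "C 0 = 1"
    using P_pos[of 0] Gamma_a by (simp add: C_def)
  have C_le: "C k \<le> (1 / 6) ^ k" for k
  proof (induction k)
    case (Suc k)
    then show ?case using C_Suc[of k] by simp
  qed (simp add: C_0)
  have eq: "fox_wright_1 q a b B z = (\<Sum>k. of_real (C k) * z ^ (k + 1))" if "norm z < 1" for z
  proof -
    let ?t = "\<lambda>k. of_real (Gamma (a + real k) / P k) * (z ^ (k + 1) / fact k)"
    have t: "of_real (C k) * z ^ (k + 1) = of_real (P 0 / Gamma a) * ?t k" for k
      by (simp add: C_def)
    have "summable (\<lambda>k. of_real (C k) * z ^ (k + 1))"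
    proof (rule summable_comparison_test'[of "\<lambda>k. (1 / 6 :: real) ^ k" 0])
      show "norm (of_real (C k) * z ^ (k + 1)) \<le> (1 / 6) ^ k" for k
        using mult_mono[OF C_le[of k] power_le_one[of "norm z" "k + 1"]] that C_nonneg[of k]
        by (simp add: norm_mult norm_power)
    qed (simp add: summable_geometric)
    moreover have "complex_of_real (P 0 / Gamma a) \<noteq> 0"
      using P_pos[of 0] Gamma_a by simp
    \<comment> \<open>The bound is known for the normalized coefficients \<open>C k\<close>;
      dividing by the nonzero constant transfers summability to the unnormalized series in the
      definition.\<close>
    ultimately have "summable ?t"
      unfolding t by (subst (asm) summable_cmult_iff) blast
    from suminf_mult[OF this, of "of_real (P 0 / Gamma a)"] show ?thesis
      unfolding t fox_wright_1_def by (simp add: P_def)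
  qed
  have "starlike_fun (\<lambda>z. \<Sum>k. of_real (C k) * z ^ (k + 1))"
    using C_nonneg C_le by (intro starlike_fun_powser_geometric) (auto simp: C_0)
  then show ?thesis
    by (subst starlike_fun_cong[OF eq])
qed

end
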